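(* Let $r_1,r_2$ be the parameters associated with the boundary conditions of Problem (P), and let $h_1,h_2$, $L(\cdot,c)$ and the sets $V^1,\dots,V^9\subset\mathbb{R}^3$ be as defined in the context. Given $c>0$, let $u_c$ denote the unique minimizer of $L(\cdot,c)$ over $\mathcal{L}^2([0,1];\mathbb{R})$, and let $q(c):=L(u_c,c)$ be the dual function. Define for $i=1,\dots,9$ a sign pair $\sigma^{(i)}$, a function $u_c^{(i)}:[0,1]\to\mathbb{R}$ and a number $q^{(i)}(c)$ by: 1. $\sigma^{(1)}=(+,+)$, $u_c^{(1)}(t)=ct-2c$, $q^{(1)}(c)=-\frac{7}{6}c^2+(r_1+r_2)c$; 2. $\sigma^{(2)}=(+,-)$, $u_c^{(2)}(t)=ct$, $q^{(2)}(c)=-\frac{1}{6}c^2+(r_1-r_2)c$; 3. $\sigma^{(3)}=(-,+)$, $u_c^{(3)}(t)=-ct$, $q^{(3)}(c)=-\frac{1}{6}c^2+(-r_1+r_2)c$; 4. $\sigma^{(4)}=(-,-)$, $u_c^{(4)}(t)=-ct+2c$, $q^{(4)}(c)=-\frac{7}{6}c^2-(r_1+r_2)c$; 5. $\sigma^{(5)}=(0,+)$, $u_c^{(5)}(t)=\frac{-3c+6r_1}{2}t+\frac{c-6r_1}{2}$, $q^{(5)}(c)=-\frac{1}{8}c^2+\left(-\frac{3}{2}r_1+r_2\right)c+\frac{3}{2}r_1^2$; 6. $\sigma^{(6)}=(0,-)$, $u_c^{(6)}(t)=\frac{3c+6r_1}{2}t-\frac{c+6r_1}{2}$, $q^{(6)}(c)=-\frac{1}{8}c^2+\left(\frac{3}{2}r_1-r_2\right)c+\frac{3}{2}r_1^2$;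 7. $\sigma^{(7)}=(+,0)$, $u_c^{(7)}(t)=ct-\frac{c+2r_2}{2}$, $q^{(7)}(c)=-\frac{1}{24}c^2+\left(r_1-\frac{1}{2}r_2\right)c+\frac{1}{2}r_2^2$; 8. $\sigma^{(8)}=(-,0)$, $u_c^{(8)}(t)=-ct+\frac{c-2r_2}{2}$, $q^{(8)}(c)=-\frac{1}{24}c^2+\left(\frac{1}{2}r_2-r_1\right)c+\frac{1}{2}r_2^2$; 9. $\sigma^{(9)}=(0,0)$, $u_c^{(9)}(t)=(12r_1-6r_2)t-6r_1+2r_2$, $q^{(9)}(c)=6r_1^2-6r_1r_2+2r_2^2$. Then, depending on the signs of $h_1(u_c)$ and $h_2(u_c)$, one and only one of the nine cases holds, and for each $i\in\{1,\dots,9\}$ the following three statements are equivalent: (iA) $(\operatorname{sign}(h_1(u_c)),\operatorname{sign}(h_2(u_c)))=\sigma^{(i)}$; (iB) the minimizer of $L(\cdot,c)$ is $u_c=u_c^{(i)}$; (iC) the dual function is $q(c)=q^{(i)}(c)$, with $(r_1,r_2,c)\in V^i$.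
   Context: Problem (P), with boundary data $s_0,s_f,v_0,v_f\in\mathbb{R}$: minimize $\frac12\int_0^1u^2(t)\,dt$ over $u\in\mathcal{L}^2([0,1];\mathbb{R})$ subject to $\dot x_1=x_2$, $\dot x_2=u$, $x_1(0)=s_0$, $x_1(1)=s_f$, $x_2(0)=v_0$, $x_2(1)=v_f$. The parameters associated with the boundary conditions are $r_1:=v_0+s_0-s_f$, $r_2:=v_0-v_f$. The constraint functions are $$h_1(u):=r_1+\int_0^1\Big[\int_0^\tau u(s)\,ds\Big]d\tau,\qquad h_2(u):=r_2+\int_0^1u(\tau)\,d\tau,$$ so that the constraints of (P) read $h_1(u)=h_2(u)=0$. For $c>0$, $$L(u,c):=\tfrac12\int_0^1u^2(t)\,dt+c\,|h_1(u)|+c\,|h_2(u)|.$$ The function $L(\cdot,c)$ has a unique minimizer over $\mathcal{L}^2([0,1];\mathbb{R})$. Here $\operatorname{sign}(a)$ is $+$ (i.e. $1$) if $a>0$, $-$ (i.e. $-1$) if $a<0$, and $0$ if $a=0$. Regions of the $(r_1,r_2)$-plane: $S_{I}$: $r_1,r_2>0$, $r_2<\frac95r_1$. $S_{II}$: $r_1,r_2>0$, $\frac95r_1<r_2\le3r_1$. $S_{III}$: $r_1,r_2>0$, $r_2>3r_1$. $S_{IV}$: $r_1\le0$, $r_2>0$. $S_{V}$: $r_1,r_2<0$, $r_2>\frac95r_1$. $S_{VI}$: $r_1,r_2<0$, $3r_1\le r_2<\frac95r_1$. $S_{VII}$: $r_1,r_2<0$, $r_2<3r_1$. $S_{VIII}$: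 $r_1\ge0$, $r_2<0$. $S_{IX}$: $r_1>0$, $r_2=\frac95r_1$. $S_{X}$: $r_1<0$, $r_2=\frac95r_1$. $S_{XI}$: $r_1>0$, $r_2=0$. $S_{XII}$: $r_1<0$, $r_2=0$. The sets $V^i$ consist of the triples $(r_1,r_2,c)\in\mathbb{R}^3$ with $c>0$ such that: $V^1$: $(r_1,r_2)\in S_I\cup S_{II}\cup S_{III}\cup S_{IX}$ and $0<c<\min\{\frac65r_1,\frac23r_2\}$. $V^2$: $(r_1,r_2)\in S_{VII}$ and $-6r_1<c<-2r_2$; or $(r_1,r_2)\in S_{VIII}$ and $0<c<-2r_2$. $V^3$: $(r_1,r_2)\in S_{III}$ and $6r_1<c<2r_2$; or $(r_1,r_2)\in S_{IV}$ and $0<c<2r_2$. $V^4$: $(r_1,r_2)\in S_V\cup S_{VI}\cup S_{VII}\cup S_X$ and $0<c<\min\{-\frac65r_1,-\frac23r_2\}$. $V^5$: $(r_1,r_2)\in S_{II}$ and $\frac65r_1\le c<-6r_1+4r_2$; or $(r_1,r_2)\in S_{III}$ and $\frac65r_1\le c\le6r_1$. $V^6$: $(r_1,r_2)\in S_{VI}$ and $-\frac65r_1\le c<6r_1-4r_2$; or $(r_1,r_2)\in S_{VII}$ and $-\frac65r_1\le c\le-6r_1$. $V^7$: $(r_1,r_2)\in S_{VII}\cup S_{VIII}$ and $-2r_2\le c<12r_1-6r_2$; or $(r_1,r_2)\in S_I$ and $\frac23r_2\le c<12r_1-6r_2$; or $(r_1,r_2)\in S_{XI}$ and $0<c<12r_1-6r_2$.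 $V^8$: $(r_1,r_2)\in S_{III}\cup S_{IV}$ and $2r_2\le c<-12r_1+6r_2$; or $(r_1,r_2)\in S_V$ and $-\frac23r_2\le c<-12r_1+6r_2$; or $(r_1,r_2)\in S_{XII}$ and $0<c<-12r_1+6r_2$. $V^9$: $c\ge\max\{|12r_1-6r_2|,|-6r_1+4r_2|\}$.
   Formalization: (iB)⇒(iA) fails where two candidates coincide (r1=5, r2=10, c=6: u^(1)=u^(5) is the minimizer, h1=0), so (iA)⇔(iB) is claimed with (r1,r2,c) in V^i added to (iB), or literally unless (r1,r2,c) is in some V^j, j≠i, with u^(j)=u^(i). *)

theory Defs
  imports "HOL-Analysis.Analysis"
begin

text \<open>Representatives of \<^emph>\<open>L2([0,1])\<close>: only the values on \<^term>\<open>{0..1::real}\<close> matter, and equality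
  of two elements is equality almost everywhere on \<^term>\<open>{0..1::real}\<close>.\<close>

definition L2_unit :: "(real \<Rightarrow> real) set" where
  "L2_unit = {u. set_borel_measurable lebesgue {0..1} u \<and>
                 set_integrable lebesgue {0..1} (\<lambda>t. (u t)\<^sup>2)}"

definition h1 :: "real \<Rightarrow> (real \<Rightarrow> real) \<Rightarrow> real" where
  "h1 r1 u = r1 + (LINT \<tau>:{0..1}|lebesgue. (LINT s:{0..\<tau>}|lebesgue. u s))"

definition h2 :: "real \<Rightarrow> (real \<Rightarrow> real) \<Rightarrow> real" where
  "h2 r2 u = r2 + (LINT \<tau>:{0..1}|lebesgue. u \<tau>)"

definition L :: "real \<Rightarrow> real \<Rightarrow> (real \<Rightarrow> real) \<Rightarrow> real \<Rightarrow> real" where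
  "L r1 r2 u c = 1 / 2 * (LINT t:{0..1}|lebesgue. (u t)\<^sup>2) + c * \<bar>h1 r1 u\<bar> + c * \<bar>h2 r2 u\<bar>"

definition S_I    :: "(real \<times> real) set" where
  "S_I    = {(r1, r2). r1 > 0 \<and> r2 > 0 \<and> r2 < 9/5 * r1}"
definition S_II   :: "(real \<times> real) set" where
  "S_II   = {(r1, r2). r1 > 0 \<and> r2 > 0 \<and> 9/5 * r1 < r2 \<and> r2 \<le> 3 * r1}"
definition S_III  :: "(real \<times> real) set" where
  "S_III  = {(r1, r2). r1 > 0 \<and> r2 > 0 \<and> r2 > 3 * r1}"
definition S_IV   :: "(real \<times> real) set" where
  "S_IV   = {(r1, r2). r1 \<le> 0 \<and> r2 > 0}"
definition S_V    :: "(real \<times> real) set" where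
  "S_V    = {(r1, r2). r1 < 0 \<and> r2 < 0 \<and> r2 > 9/5 * r1}"
definition S_VI   :: "(real \<times> real) set" where
  "S_VI   = {(r1, r2). r1 < 0 \<and> r2 < 0 \<and> 3 * r1 \<le> r2 \<and> r2 < 9/5 * r1}"
definition S_VII  :: "(real \<times> real) set" where
  "S_VII  = {(r1, r2). r1 < 0 \<and> r2 < 0 \<and> r2 < 3 * r1}"
definition S_VIII :: "(real \<times> real) set" where
  "S_VIII = {(r1, r2). r1 \<ge> 0 \<and> r2 < 0}"
definition S_IX   :: "(real \<times> real) set" where
  "S_IX   = {(r1, r2). r1 > 0 \<and> r2 = 9/5 * r1}"
definition S_X    :: "(real \<times> real) set" where
  "S_X    = {(r1, r2). r1 < 0 \<and> r2 = 9/5 * r1}"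
definition S_XI   :: "(real \<times> real) set" where
  "S_XI   = {(r1, r2). r1 > 0 \<and> r2 = 0}"
definition S_XII  :: "(real \<times> real) set" where
  "S_XII  = {(r1, r2). r1 < 0 \<and> r2 = 0}"

datatype idx = I1 | I2 | I3 | I4 | I5 | I6 | I7 | I8 | I9

fun V :: "idx \<Rightarrow> (real \<times> real \<times> real) set" where
  "V I1 = {(r1, r2, c). c > 0 \<and>
     (r1, r2) \<in> S_I \<union> S_II \<union> S_III \<union> S_IX \<and> c < min (6/5 * r1) (2/3 * r2)}"
| "V I2 = {(r1, r2, c). c > 0 \<and>
     ((r1, r2) \<in> S_VII \<and> -6 * r1 < c \<and> c < -2 * r2 \<or>
      (r1, r2) \<in> S_VIII \<and> c < -2 * r2)}"
| "V I3 = {(r1, r2, c). c > 0 \<and>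
     ((r1, r2) \<in> S_III \<and> 6 * r1 < c \<and> c < 2 * r2 \<or>
      (r1, r2) \<in> S_IV \<and> c < 2 * r2)}"
| "V I4 = {(r1, r2, c). c > 0 \<and>
     (r1, r2) \<in> S_V \<union> S_VI \<union> S_VII \<union> S_X \<and> c < min (- (6/5) * r1) (- (2/3) * r2)}"
| "V I5 = {(r1, r2, c). c > 0 \<and>
     ((r1, r2) \<in> S_II \<and> 6/5 * r1 \<le> c \<and> c < -6 * r1 + 4 * r2 \<or>
      (r1, r2) \<in> S_III \<and> 6/5 * r1 \<le> c \<and> c \<le> 6 * r1)}"
| "V I6 = {(r1, r2, c). c > 0 \<and>
     ((r1, r2) \<in> S_VI \<and> - (6/5) * r1 \<le> c \<and> c < 6 * r1 - 4 * r2 \<or>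
      (r1, r2) \<in> S_VII \<and> - (6/5) * r1 \<le> c \<and> c \<le> -6 * r1)}"
| "V I7 = {(r1, r2, c). c > 0 \<and>
     ((r1, r2) \<in> S_VII \<union> S_VIII \<and> -2 * r2 \<le> c \<and> c < 12 * r1 - 6 * r2 \<or>
      (r1, r2) \<in> S_I \<and> 2/3 * r2 \<le> c \<and> c < 12 * r1 - 6 * r2 \<or>
      (r1, r2) \<in> S_XI \<and> c < 12 * r1 - 6 * r2)}"
| "V I8 = {(r1, r2, c). c > 0 \<and>
     ((r1, r2) \<in> S_III \<union> S_IV \<and> 2 * r2 \<le> c \<and> c < -12 * r1 + 6 * r2 \<or>
      (r1, r2) \<in> S_V \<and> - (2/3) * r2 \<le> c \<and> c < -12 * r1 + 6 * r2 \<or>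
      (r1, r2) \<in> S_XII \<and> c < -12 * r1 + 6 * r2)}"
| "V I9 = {(r1, r2, c). c > 0 \<and> c \<ge> max \<bar>12 * r1 - 6 * r2\<bar> \<bar>-6 * r1 + 4 * r2\<bar>}"

fun sgn_pair :: "idx \<Rightarrow> real \<times> real" where
  "sgn_pair I1 = (1, 1)"
| "sgn_pair I2 = (1, -1)"
| "sgn_pair I3 = (-1, 1)"
| "sgn_pair I4 = (-1, -1)"
| "sgn_pair I5 = (0, 1)"
| "sgn_pair I6 = (0, -1)"
| "sgn_pair I7 = (1, 0)"
| "sgn_pair I8 = (-1, 0)"
| "sgn_pair I9 = (0, 0)"

fun u_cand :: "real \<Rightarrow> real \<Rightarrow> real \<Rightarrow> idx \<Rightarrow> real \<Rightarrow> real" where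
  "u_cand r1 r2 c I1 t = c * t - 2 * c"
| "u_cand r1 r2 c I2 t = c * t"
| "u_cand r1 r2 c I3 t = - c * t"
| "u_cand r1 r2 c I4 t = - c * t + 2 * c"
| "u_cand r1 r2 c I5 t = (-3 * c + 6 * r1) / 2 * t + (c - 6 * r1) / 2"
| "u_cand r1 r2 c I6 t = (3 * c + 6 * r1) / 2 * t - (c + 6 * r1) / 2"
| "u_cand r1 r2 c I7 t = c * t - (c + 2 * r2) / 2"
| "u_cand r1 r2 c I8 t = - c * t + (c - 2 * r2) / 2"
| "u_cand r1 r2 c I9 t = (12 * r1 - 6 * r2) * t - 6 * r1 + 2 * r2"

fun q_cand :: "real \<Rightarrow> real \<Rightarrow> real \<Rightarrow> idx \<Rightarrow> real" where
  "q_cand r1 r2 c I1 = - (7/6) * c\<^sup>2 + (r1 + r2) * c"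
| "q_cand r1 r2 c I2 = - (1/6) * c\<^sup>2 + (r1 - r2) * c"
| "q_cand r1 r2 c I3 = - (1/6) * c\<^sup>2 + (- r1 + r2) * c"
| "q_cand r1 r2 c I4 = - (7/6) * c\<^sup>2 - (r1 + r2) * c"
| "q_cand r1 r2 c I5 = - (1/8) * c\<^sup>2 + (- (3/2) * r1 + r2) * c + 3/2 * r1\<^sup>2"
| "q_cand r1 r2 c I6 = - (1/8) * c\<^sup>2 + (3/2 * r1 - r2) * c + 3/2 * r1\<^sup>2"
| "q_cand r1 r2 c I7 = - (1/24) * c\<^sup>2 + (r1 - 1/2 * r2) * c + 1/2 * r2\<^sup>2"
| "q_cand r1 r2 c I8 = - (1/24) * c\<^sup>2 + (1/2 * r2 - r1) * c + 1/2 * r2\<^sup>2"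
| "q_cand r1 r2 c I9 = 6 * r1\<^sup>2 - 6 * r1 * r2 + 2 * r2\<^sup>2"

text \<open>On common boundaries of the regions two of the candidates are the same function: for
  \<open>r1 = 5\<close>, \<open>r2 = 10\<close>, \<open>c = 6\<close> the candidates \<open>I1\<close> and \<open>I5\<close> are both \<open>6 * t - 12\<close>, which is the
  minimizer, while \<open>h1\<close> vanishes there. At such points the formula for the minimizer does not
  determine the signs. \<open>ambiguous r1 r2 c i\<close> says that the parameters belong to another case
  whose candidate happens to coincide with the one of case \<open>i\<close>.\<close>

definition ambiguous :: "real \<Rightarrow> real \<Rightarrow> real \<Rightarrow> idx \<Rightarrow> bool" where
  "ambiguous r1 r2 c i \<longleftrightarrow>
     (\<exists>j. j \<noteq> i \<and> (r1, r2, c) \<in> V j \<and> (\<forall>t\<in>{0..1}. u_cand r1 r2 c j t = u_cand r1 r2 c i t))"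

end

theory Submission
  imports Defs
begin

text \<open>By Fubini \<open>h1\<close> is affine with gradient \<open>1 - t\<close>, and \<open>h2\<close> is affine with gradient \<open>1\<close>. If
  \<open>v t = - l1 * (1 - t) - l2\<close> with \<open>\<bar>l1\<bar> \<le> c\<close>, \<open>\<bar>l2\<bar> \<le> c\<close> and \<open>li * hi v = c * \<bar>hi v\<bar>\<close>, then
  replacing \<open>c * \<bar>hi u\<bar>\<close> by its lower bound \<open>li * hi u\<close> and completing the square shows that
  \<open>L u\<close> exceeds \<open>L v\<close> by at least half the squared L2 distance of \<open>u\<close> and \<open>v\<close>; so \<open>v\<close> is the
  minimizer up to a null set. On each \<open>V i\<close> the \<open>i\<close>-th candidate satisfies these conditions
  with exactly the prescribed signs, and the sets \<open>V i\<close> cover the half space \<open>c > 0\<close>, hence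
  partition it.\<close>

section \<open>Fubini for the double integral in \<open>h1\<close>\<close>

lemma sigma_finite_lebesgue: "sigma_finite_measure (lebesgue :: 'a::euclidean_space measure)"
proof
  obtain A :: "'a set set" where A: "countable A" "A \<subseteq> sets lborel" "\<Union>A = space lborel"
    "\<forall>a\<in>A. emeasure lborel a \<noteq> \<infinity>"
    using lborel.sigma_finite_countable by metis
  show "\<exists>A::'a set set. countable A \<and> A \<subseteq> sets lebesgue \<and> \<Union>A = space lebesgue \<and>
      (\<forall>a\<in>A. emeasure lebesgue a \<noteq> \<infinity>)"
  proof (intro exI conjI ballI)
    fix a assume a: "a \<in> A"
    with A have "emeasure lebesgue a = emeasure lborel a"
      by (auto simp: subset_eq)
    with a A show "emeasure lebesgue a \<noteq> \<infinity>" by simp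
  qed (use A in \<open>auto simp: space_completion\<close>)
qed

text \<open>Both sides integrate \<open>u s\<close> over the triangle
  \<open>0 \<le> s \<le> \<tau> \<le> 1\<close>, whose section at fixed \<open>s\<close> has length
  \<open>1 - s\<close>.\<close>

lemma LINT_iterated_unit_interval:
  fixes u :: "real \<Rightarrow> real"
  assumes u: "set_integrable lebesgue {0..1} u"
  shows "(LINT \<tau>:{0..1}|lebesgue. (LINT s:{0..\<tau>}|lebesgue. u s)) =
         (LINT s:{0..1}|lebesgue. (1 - s) * u s)"
proof -
  interpret sigma_finite_measure "lebesgue :: real measure" by (rule sigma_finite_lebesgue)
  interpret pair_sigma_finite "lebesgue :: real measure" "lebesgue :: real measure" ..
  define g where "g = (\<lambda>s. indicator {0..1} s * u s)"
  define F where "F = (\<lambda>(s, \<tau>). g s * (if s \<le> \<tau> \<and> \<tau> \<le> 1 then 1 else 0 :: real))"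
  have g: "integrable lebesgue g"
    using u by (simp add: g_def set_integrable_def)
  then have [measurable]: "g \<in> borel_measurable lebesgue" by auto
  have [measurable]: "(\<lambda>x::real. x) \<in> borel_measurable lebesgue"
    by (simp add: measurable_completion)
  have F [measurable]: "F \<in> borel_measurable (lebesgue \<Otimes>\<^sub>M lebesgue)"
    unfolding F_def by measurable
  have inner: "F (s, \<tau>) = g s * indicator {s..1} \<tau>" for s \<tau>
    by (auto simp: F_def indicator_def)
  have g0: "g s = 0" if "s \<notin> {0..1}" for s
    using that by (auto simp: g_def)
  have intF: "integrable lebesgue (\<lambda>\<tau>. F (s, \<tau>))" for s
    unfolding inner
    by (intro integrable_mult_right integrable_real_indicator) (auto simp: emeasure_lborel_Icc_eq)
  have int1: "(\<integral>\<tau>. F (s, \<tau>) \<partial>lebesgue) = g s * (1 - s)" for s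
    using g0[of s] by (cases "s \<in> {0..1}") (auto simp: inner)
  have int2: "(\<integral>\<tau>. norm (F (s, \<tau>)) \<partial>lebesgue) = \<bar>g s\<bar> * (1 - s)" for s
    using g0[of s] by (cases "s \<in> {0..1}") (auto simp: inner abs_mult)
  \<comment> \<open>Absolute integrability for Fubini: \<open>0 \<le> 1 - s \<le> 1\<close> wherever
    \<open>g\<close> is nonzero, so \<open>g\<close> itself dominates.\<close>
  have "integrable lebesgue (\<lambda>s. \<bar>g s\<bar> * (1 - s))"
  proof (rule Bochner_Integration.integrable_bound[OF g])
    show "AE s in lebesgue. norm (\<bar>g s\<bar> * (1 - s)) \<le> norm (g s)"
    proof (rule AE_I2)
      fix s show "norm (\<bar>g s\<bar> * (1 - s)) \<le> norm (g s)"
        using g0[of s] by (cases "s \<in> {0..1}") (auto simp: abs_mult mult_left_le)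
    qed
  qed measurable
  then have "integrable (lebesgue \<Otimes>\<^sub>M lebesgue) F"
    by (intro Fubini_integrable F AE_I2 intF) (simp only: int2)
  then have "(\<integral>\<tau>. (\<integral>s. F (s, \<tau>) \<partial>lebesgue) \<partial>lebesgue) = (\<integral>s. (\<integral>\<tau>. F (s, \<tau>) \<partial>lebesgue) \<partial>lebesgue)"
    using Fubini_integral[of "\<lambda>s \<tau>. F (s, \<tau>)"] by simp
  moreover have "(\<integral>s. F (s, \<tau>) \<partial>lebesgue) =
      indicator {0..1} \<tau> * (LINT s:{0..\<tau>}|lebesgue. u s)" for \<tau>
  proof -
    have "F (s, \<tau>) = indicator {0..1} \<tau> * (indicator {0..\<tau>} s * u s)" for s
      by (auto simp: F_def g_def indicator_def)
    then show ?thesis by (simp add: set_lebesgue_integral_def)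
  qed
  ultimately show ?thesis
    by (simp add: int1 set_lebesgue_integral_def g_def ac_simps)
qed

section \<open>Integrability in \<open>L2_unit\<close> and integrals of affine functions\<close>

lemma L2_unit_set_integrable_mult:
  assumes "u \<in> L2_unit" "v \<in> L2_unit"
  shows "set_integrable lebesgue {0..1} (\<lambda>t. u t * v t)"
proof (rule set_integrable_bound)
  show "set_integrable lebesgue {0..1} (\<lambda>t. (u t)\<^sup>2 + (v t)\<^sup>2)"
    using assms by (auto simp: L2_unit_def)
  \<comment> \<open>Measurability is known only for the functions cut off to the interval; the
    indicator is idempotent, so their product is the cut-off product.\<close>
  have "(\<lambda>t. (indicator {0..1} t *\<^sub>R u t) * (indicator {0..1} t *\<^sub>R v t)) \<in> borel_measurable lebesgue"
    using assms by (intro borel_measurable_times) (auto simp: L2_unit_def set_borel_measurable_def)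
  moreover have "(\<lambda>t. (indicator {0..1} t *\<^sub>R u t) * (indicator {0..1} t *\<^sub>R v t)) =
      (\<lambda>t. indicator {0..1} t *\<^sub>R (u t * v t))"
    by (auto simp: indicator_def)
  ultimately show "set_borel_measurable lebesgue {0..1} (\<lambda>t. u t * v t)"
    by (simp add: set_borel_measurable_def)
  have "\<bar>x * y\<bar> \<le> x\<^sup>2 + y\<^sup>2" for x y :: real
    using sum_squares_bound[of "\<bar>x\<bar>" "\<bar>y\<bar>"] mult_nonneg_nonneg[of "\<bar>x\<bar>" "\<bar>y\<bar>"]
    by (simp add: abs_mult del: mult_nonneg_nonneg)
  then show "AE t in lebesgue. t \<in> {0..1} \<longrightarrow> norm (u t * v t) \<le> norm ((u t)\<^sup>2 + (v t)\<^sup>2)"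
    by (auto intro!: AE_I2)
qed

lemma continuous_on_L2_unit:
  assumes "continuous_on {0..1} v"
  shows "v \<in> L2_unit"
proof -
  have "set_integrable lebesgue {0..1} v" "set_integrable lebesgue {0..1} (\<lambda>t. (v t)\<^sup>2)"
    using assms by (auto intro!: absolutely_integrable_continuous_real continuous_intros)
  then show ?thesis
    by (auto simp: L2_unit_def set_borel_measurable_def set_integrable_def)
qed

text \<open>The interval has finite length, so the constant 1 is square integrable and may serve as
  the other factor.\<close>

lemma L2_unit_set_integrable:
  assumes "u \<in> L2_unit"
  shows "set_integrable lebesgue {0..1} u"
  using L2_unit_set_integrable_mult[OF continuous_on_L2_unit[OF continuous_on_const[of _ 1]] assms]
  by simp

lemma L2_unit_set_integrable_moment:
  assumes "u \<in> L2_unit"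
  shows "set_integrable lebesgue {0..1} (\<lambda>s. (1 - s) * u s)"
  by (intro L2_unit_set_integrable_mult assms continuous_on_L2_unit continuous_intros)

lemma h1_eq:
  assumes "u \<in> L2_unit"
  shows "h1 r1 u = r1 + (LINT s:{0..1}|lebesgue. (1 - s) * u s)"
  using LINT_iterated_unit_interval[OF L2_unit_set_integrable[OF assms]] by (simp add: h1_def)

lemma LINT_unit_FTC:
  fixes f F :: "real \<Rightarrow> real"
  assumes "\<And>x. (F has_field_derivative f x) (at x)" and "continuous_on {0..1} f"
  shows "(LINT t:{0..1}|lebesgue. f t) = F 1 - F 0"
proof -
  have "(f has_integral F 1 - F 0) {0..1}"
    using assms(1) by (intro fundamental_theorem_of_calculus)
      (auto simp flip: has_real_derivative_iff_has_vector_derivative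
        intro: has_field_derivative_at_within)
  then show ?thesis
    using set_lebesgue_integral_eq_integral(2)[OF absolutely_integrable_continuous_real[OF assms(2)]]
    by (simp add: integral_unique)
qed

lemma affine_L2_unit: "(\<lambda>t. a * t + b) \<in> L2_unit"
  by (intro continuous_on_L2_unit continuous_intros)

lemma LINT_affine: "(LINT t:{0..1}|lebesgue. a * t + b) = a / 2 + (b::real)"
  by (subst LINT_unit_FTC[where F = "\<lambda>t. a / 2 * t^2 + b * t"])
    (auto intro!: derivative_eq_intros continuous_intros)

lemma LINT_affine_moment: "(LINT t:{0..1}|lebesgue. (1 - t) * (a * t + b)) = a / 6 + (b::real) / 2"
  by (subst LINT_unit_FTC[where F = "\<lambda>t. b * t + (a - b) / 2 * t^2 - a / 3 * t^3"])
    (auto intro!: derivative_eq_intros continuous_intros simp: field_simps power2_eq_square)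

lemma LINT_affine_square: "(LINT t:{0..1}|lebesgue. (a * t + b)\<^sup>2) = a\<^sup>2 / 3 + a * b + (b::real)\<^sup>2"
  by (subst LINT_unit_FTC[where F = "\<lambda>t. a^2 / 3 * t^3 + a * b * t^2 + b^2 * t"])
    (auto intro!: derivative_eq_intros continuous_intros simp: field_simps power2_eq_square)

lemma h1_affine: "h1 r1 (\<lambda>t. a * t + b) = r1 + a / 6 + b / 2"
  by (simp add: h1_eq affine_L2_unit LINT_affine_moment)

lemma h2_affine: "h2 r2 (\<lambda>t. a * t + b) = r2 + a / 2 + b"
  by (simp add: h2_def LINT_affine)

lemma L_affine:
  "L r1 r2 (\<lambda>t. a * t + b) c =
     (a\<^sup>2 / 3 + a * b + b\<^sup>2) / 2 + c * \<bar>r1 + a / 6 + b / 2\<bar> + c * \<bar>r2 + a / 2 + b\<bar>"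
  by (simp add: L_def h1_affine h2_affine LINT_affine_square)

text \<open>Writing \<open>a * t + b\<close> as \<open>(a + b) - a * (1 - t)\<close> expresses the
  cross term through the two integrals that occur in \<open>h1\<close> and
  \<open>h2\<close>.\<close>

lemma LINT_diff_affine_square:
  assumes u: "u \<in> L2_unit"
  shows "set_integrable lebesgue {0..1} (\<lambda>t. (u t - (a * t + b))\<^sup>2)"
    and "(LINT t:{0..1}|lebesgue. (u t - (a * t + b))\<^sup>2) =
      (LINT t:{0..1}|lebesgue. (u t)\<^sup>2) + 2 * a * (LINT t:{0..1}|lebesgue. (1 - t) * u t)
      - 2 * (a + b) * (LINT t:{0..1}|lebesgue. u t) + (a\<^sup>2 / 3 + a * b + b\<^sup>2)"
proof -
  have eq: "(u t - (a * t + b))\<^sup>2 =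
      ((u t)\<^sup>2 + 2 * a * ((1 - t) * u t)) + ((- 2 * (a + b)) * u t + (a * t + b)\<^sup>2)" for t
    by (simp add: power2_eq_square algebra_simps)
  have i2: "set_integrable lebesgue {0..1} (\<lambda>t. (u t)\<^sup>2)"
    using u by (simp add: L2_unit_def)
  have i1: "set_integrable lebesgue {0..1} (\<lambda>t. 2 * a * ((1 - t) * u t))"
    using L2_unit_set_integrable_moment[OF u] by (intro set_integrable_mult_right)
  have i0: "set_integrable lebesgue {0..1} (\<lambda>t. (- 2 * (a + b)) * u t)"
    using L2_unit_set_integrable[OF u] by (intro set_integrable_mult_right)
  have iv: "set_integrable lebesgue {0..1} (\<lambda>t. (a * t + b)\<^sup>2)"
    using affine_L2_unit[of a b] by (simp add: L2_unit_def)
  show "set_integrable lebesgue {0..1} (\<lambda>t. (u t - (a * t + b))\<^sup>2)"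
    unfolding eq by (intro set_integral_add i0 i1 i2 iv)
  show "(LINT t:{0..1}|lebesgue. (u t - (a * t + b))\<^sup>2) =
      (LINT t:{0..1}|lebesgue. (u t)\<^sup>2) + 2 * a * (LINT t:{0..1}|lebesgue. (1 - t) * u t)
      - 2 * (a + b) * (LINT t:{0..1}|lebesgue. u t) + (a\<^sup>2 / 3 + a * b + b\<^sup>2)"
    unfolding eq
    unfolding set_integral_add(2)[OF set_integral_add(1)[OF i2 i1] set_integral_add(1)[OF i0 iv]]
      set_integral_add(2)[OF i2 i1] set_integral_add(2)[OF i0 iv]
      set_integral_mult_right LINT_affine_square
    by (simp add: algebra_simps)
qed

section \<open>Optimality and uniqueness from multipliers\<close>

text \<open>The hypotheses are the Karush-Kuhn-Tucker conditions, with multipliers \<open>a\<close> for \<open>h1\<close> and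
  \<open>- (a + b)\<close> for \<open>h2\<close>.\<close>

lemma L_affine_quadratic_growth:
  assumes u: "u \<in> L2_unit" and "\<bar>a\<bar> \<le> c" "\<bar>a + b\<bar> \<le> c"
    and "a * (r1 + a / 6 + b / 2) = c * \<bar>r1 + a / 6 + b / 2\<bar>"
    and "- (a + b) * (r2 + a / 2 + b) = c * \<bar>r2 + a / 2 + b\<bar>"
  shows "L r1 r2 (\<lambda>t. a * t + b) c + 1 / 2 * (LINT t:{0..1}|lebesgue. (u t - (a * t + b))\<^sup>2)
    \<le> L r1 r2 u c"
proof -
  define m0 m1 where "m0 = (LINT t:{0..1}|lebesgue. u t)"
    and "m1 = (LINT t:{0..1}|lebesgue. (1 - t) * u t)"
  have mult: "x * y \<le> c * \<bar>y\<bar>" if "\<bar>x\<bar> \<le> c" for x y :: real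
    using mult_right_mono[OF that abs_ge_zero[of y]] abs_ge_self[of "x * y"] by (simp add: abs_mult)
  have "a * (r1 + m1) \<le> c * \<bar>r1 + m1\<bar>" "- (a + b) * (r2 + m0) \<le> c * \<bar>r2 + m0\<bar>"
    using mult[of a "r1 + m1"] mult[of "- (a + b)" "r2 + m0"] assms(2,3)
    unfolding abs_minus_cancel by blast+
  then show ?thesis
    \<comment> \<open>The right side minus the left side is exactly the sum of the slacks of the two
      inequalities just shown; the terms quadratic in \<open>a\<close> and \<open>b\<close>
      cancel.\<close>
    unfolding L_affine LINT_diff_affine_square[OF u]
    unfolding L_def h1_eq[OF u] h2_def m0_def[symmetric] m1_def[symmetric]
      assms(4)[symmetric] assms(5)[symmetric]
    by (simp add: algebra_simps power2_eq_square add_divide_distrib diff_divide_distrib)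
qed

text \<open>Quadratic growth leaves a minimizer no positive L2 distance from the affine
  function.\<close>

lemma arg_min_L_affine:
  assumes min: "is_arg_min (\<lambda>u. L r1 r2 u c) (\<lambda>u. u \<in> L2_unit) w"
    and "\<bar>a\<bar> \<le> c" "\<bar>a + b\<bar> \<le> c"
    and "a * (r1 + a / 6 + b / 2) = c * \<bar>r1 + a / 6 + b / 2\<bar>"
    and "- (a + b) * (r2 + a / 2 + b) = c * \<bar>r2 + a / 2 + b\<bar>"
  shows "AE t\<in>{0..1} in lebesgue. w t = a * t + b"
proof -
  define D where "D = (\<lambda>t. indicator {0..1} t * (w t - (a * t + b))\<^sup>2)"
  have w: "w \<in> L2_unit" and "L r1 r2 w c \<le> L r1 r2 (\<lambda>t. a * t + b) c"
    using min affine_L2_unit by (auto simp: is_arg_min_linorder)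
  then have "(LINT t:{0..1}|lebesgue. (w t - (a * t + b))\<^sup>2) \<le> 0"
    using L_affine_quadratic_growth[OF w assms(2-5)] by linarith
  then have "integral\<^sup>L lebesgue D \<le> 0"
    by (simp add: D_def set_lebesgue_integral_def)
  moreover have D0: "D t \<ge> 0" for t by (simp add: D_def)
  ultimately have "integral\<^sup>L lebesgue D = 0"
    by (intro antisym integral_nonneg_AE) auto
  moreover have "integrable lebesgue D"
    using LINT_diff_affine_square(1)[OF w] by (simp add: D_def set_integrable_def)
  ultimately have "AE t in lebesgue. D t = 0"
    using integral_nonneg_eq_0_iff_AE[of lebesgue D] D0 by auto
  then show ?thesis
    by eventually_elim (auto simp: D_def)
qed

text \<open>A minimizer is identified only up to a null set; this carries signs and value over from
  the candidate.\<close>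

lemma AE_unit_interval_cong:
  assumes "u \<in> L2_unit" "v \<in> L2_unit" and ae: "AE t\<in>{0..1} in lebesgue. u t = v t"
  shows "h1 r1 u = h1 r1 v" "h2 r2 u = h2 r2 v" "L r1 r2 u c = L r1 r2 v c"
proof -
  have cong: "(LINT t:{0..1}|lebesgue. f t) = (LINT t:{0..1}|lebesgue. g t)"
    if "set_integrable lebesgue {0..1} f" "set_integrable lebesgue {0..1} g"
      and fg: "AE t\<in>{0..1} in lebesgue. f t = g t"
    for f g :: "real \<Rightarrow> real"
    unfolding set_lebesgue_integral_def
  proof (rule integral_cong_AE)
    show "AE t in lebesgue. indicator {0..1} t *\<^sub>R f t = indicator {0..1} t *\<^sub>R g t"
      using fg by eventually_elim (auto simp: indicator_def)
  qed (use that in \<open>auto simp: set_integrable_def\<close>)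
  have "(LINT t:{0..1}|lebesgue. (1 - t) * u t) = (LINT t:{0..1}|lebesgue. (1 - t) * v t)"
    by (intro cong L2_unit_set_integrable_moment assms) (use ae in \<open>eventually_elim, auto\<close>)
  then show h1: "h1 r1 u = h1 r1 v" by (simp add: h1_eq assms)
  have "(LINT t:{0..1}|lebesgue. u t) = (LINT t:{0..1}|lebesgue. v t)"
    by (intro cong L2_unit_set_integrable assms)
  then show h2: "h2 r2 u = h2 r2 v" by (simp add: h2_def)
  have "(LINT t:{0..1}|lebesgue. (u t)\<^sup>2) = (LINT t:{0..1}|lebesgue. (v t)\<^sup>2)"
    by (intro cong) (use assms in \<open>auto simp: L2_unit_def\<close>)
  then show "L r1 r2 u c = L r1 r2 v c" by (simp add: L_def h1 h2)
qed

text \<open>The squared L2 norm of an affine function is a positive definite quadratic form in its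
  coefficients.\<close>

lemma AE_affine_eq:
  fixes a b a' b' :: real
  assumes "AE t\<in>{0..1} in lebesgue. a * t + b = a' * t + b'"
  shows "a = a'" "b = b'"
proof -
  have "(LINT t:{0..1}|lebesgue. (a * t + b - (a' * t + b'))\<^sup>2) = 0"
    unfolding set_lebesgue_integral_def
  proof (rule integral_eq_zero_AE)
    show "AE t in lebesgue. indicator {0..1} t *\<^sub>R (a * t + b - (a' * t + b'))\<^sup>2 = 0"
      using assms
    proof eventually_elim
      case (elim t)
      then show ?case by (cases "t \<in> {0..1}") simp_all
    qed
  qed
  also have "(\<lambda>t. (a * t + b - (a' * t + b'))\<^sup>2) = (\<lambda>t. ((a - a') * t + (b - b'))\<^sup>2)"
    by (simp add: algebra_simps)
  finally have "(a - a')\<^sup>2 / 3 + (a - a') * (b - b') + (b - b')\<^sup>2 = 0"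
    by (simp add: LINT_affine_square)
  \<comment> \<open>Completing the square:
    \<open>x^2 / 3 + x * y + y^2 = x^2 / 12 + (x / 2 + y)^2\<close>.\<close>
  then have "(a - a')\<^sup>2 / 12 + ((a - a') / 2 + (b - b'))\<^sup>2 = 0"
    by (simp add: power2_eq_square field_simps)
  moreover have "0 \<le> (a - a')\<^sup>2" "0 \<le> ((a - a') / 2 + (b - b'))\<^sup>2"
    by (rule zero_le_power2)+
  ultimately have "(a - a')\<^sup>2 = 0" "((a - a') / 2 + (b - b'))\<^sup>2 = 0"
    by linarith+
  then have *: "a - a' = 0" "(a - a') / 2 + (b - b') = 0"
    by (simp_all only: zero_eq_power2)
  show "a = a'" using * by simp
  show "b = b'" using *(2) unfolding *(1) by simp
qed

section \<open>The nine candidates and their regions\<close>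

fun cand_slope :: "real \<Rightarrow> real \<Rightarrow> real \<Rightarrow> idx \<Rightarrow> real" where
  "cand_slope r1 r2 c I1 = c"
| "cand_slope r1 r2 c I2 = c"
| "cand_slope r1 r2 c I3 = - c"
| "cand_slope r1 r2 c I4 = - c"
| "cand_slope r1 r2 c I5 = (-3 * c + 6 * r1) / 2"
| "cand_slope r1 r2 c I6 = (3 * c + 6 * r1) / 2"
| "cand_slope r1 r2 c I7 = c"
| "cand_slope r1 r2 c I8 = - c"
| "cand_slope r1 r2 c I9 = 12 * r1 - 6 * r2"

lemma u_cand_affine: "u_cand r1 r2 c i t = cand_slope r1 r2 c i * t + u_cand r1 r2 c i 0"
  by (cases i) auto

text \<open>For \<open>c > 0\<close> the bounds on \<open>c\<close> confine \<open>(r1, r2)\<close>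
  to the listed regions, and alternatives within a \<open>V i\<close> record which bound is the
  active one. In \<open>V I5\<close>, for instance, the two upper bounds agree on
  \<open>r2 = 3 * r1\<close>. Each \<open>V i\<close> thus becomes a single system of linear
  inequalities.\<close>

lemma V_iff:
  assumes "c > 0"
  shows "(r1, r2, c) \<in> V I1 \<longleftrightarrow> c < 6/5 * r1 \<and> c < 2/3 * r2"
    and "(r1, r2, c) \<in> V I2 \<longleftrightarrow> - 6 * r1 < c \<and> c < - 2 * r2"
    and "(r1, r2, c) \<in> V I3 \<longleftrightarrow> 6 * r1 < c \<and> c < 2 * r2"
    and "(r1, r2, c) \<in> V I4 \<longleftrightarrow> c < - (6/5) * r1 \<and> c < - (2/3) * r2"
    and "(r1, r2, c) \<in> V I5 \<longleftrightarrow> 6/5 * r1 \<le> c \<and> c \<le> 6 * r1 \<and> c < - 6 * r1 + 4 * r2"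
    and "(r1, r2, c) \<in> V I6 \<longleftrightarrow> - (6/5) * r1 \<le> c \<and> c \<le> - 6 * r1 \<and> c < 6 * r1 - 4 * r2"
    and "(r1, r2, c) \<in> V I7 \<longleftrightarrow> 2/3 * r2 \<le> c \<and> - 2 * r2 \<le> c \<and> c < 12 * r1 - 6 * r2"
    and "(r1, r2, c) \<in> V I8 \<longleftrightarrow> - (2/3) * r2 \<le> c \<and> 2 * r2 \<le> c \<and> c < - 12 * r1 + 6 * r2"
    and "(r1, r2, c) \<in> V I9 \<longleftrightarrow> \<bar>12 * r1 - 6 * r2\<bar> \<le> c \<and> \<bar>- 6 * r1 + 4 * r2\<bar> \<le> c"
  using assms
  unfolding V.simps S_I_def S_II_def S_III_def S_IV_def S_V_def S_VI_def S_VII_def S_VIII_def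
    S_IX_def S_X_def S_XI_def S_XII_def Un_iff mem_Collect_eq prod.case
    min_less_iff_conj max.bounded_iff
  by argo+

lemma V_pos: "(r1, r2, c) \<in> V i \<Longrightarrow> c > 0"
  by (cases i) auto

text \<open>The non-strict inequalities in \<open>V_iff\<close> are the bounds on the multipliers,
  the strict ones give the nonzero signs; a sign 0 holds identically by the choice of the
  candidate.\<close>

lemma V_KKT:
  assumes V: "(r1, r2, c) \<in> V i"
  defines "a \<equiv> cand_slope r1 r2 c i" and "b \<equiv> u_cand r1 r2 c i 0"
  shows "\<bar>a\<bar> \<le> c" "\<bar>a + b\<bar> \<le> c"
    and "(sgn (r1 + a / 6 + b / 2), sgn (r2 + a / 2 + b)) = sgn_pair i"
    and "a * (r1 + a / 6 + b / 2) = c * \<bar>r1 + a / 6 + b / 2\<bar>"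
    and "- (a + b) * (r2 + a / 2 + b) = c * \<bar>r2 + a / 2 + b\<bar>"
proof -
  have c: "c > 0" using V by (rule V_pos)
  show "\<bar>a\<bar> \<le> c" "\<bar>a + b\<bar> \<le> c"
    using V V_iff[OF c] c
    by (cases i; auto simp: a_def b_def abs_le_iff field_simps simp del: V.simps)+
  show sgn: "(sgn (r1 + a / 6 + b / 2), sgn (r2 + a / 2 + b)) = sgn_pair i"
    using V V_iff[OF c] c
    by (cases i) (auto simp: a_def b_def sgn_if field_simps simp del: V.simps)
  \<comment> \<open>Complementary slackness: a nonzero sign goes with the extremal multiplier
    \<open>c\<close> times that sign, while for sign 0 both sides vanish.\<close>
  have "fst (sgn_pair i) = 0 \<or> a = c * fst (sgn_pair i)"
    unfolding a_def by (cases i) simp_all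
  moreover have "snd (sgn_pair i) = 0 \<or> - (a + b) = c * snd (sgn_pair i)"
    unfolding a_def b_def by (cases i) (simp_all add: field_simps)
  moreover have "x * y = c * \<bar>y\<bar>" if "sgn y = 0 \<or> x = c * sgn y" for x y :: real
    using that by (auto simp: abs_sgn sgn_zero_iff)
  ultimately show "a * (r1 + a / 6 + b / 2) = c * \<bar>r1 + a / 6 + b / 2\<bar>"
    "- (a + b) * (r2 + a / 2 + b) = c * \<bar>r2 + a / 2 + b\<bar>"
    unfolding sgn[symmetric] fst_conv snd_conv by blast+
qed

text \<open>Complementary slackness removes the absolute values, leaving a polynomial identity in
  each case.\<close>

lemma L_cand_eq_q_cand:
  assumes "(r1, r2, c) \<in> V i"
  shows "L r1 r2 (u_cand r1 r2 c i) c = q_cand r1 r2 c i"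
proof -
  define a b where "a = cand_slope r1 r2 c i" and "b = u_cand r1 r2 c i 0"
  have "u_cand r1 r2 c i = (\<lambda>t. a * t + b)"
    using u_cand_affine unfolding a_def b_def by blast
  then have "L r1 r2 (u_cand r1 r2 c i) c = (a\<^sup>2 / 3 + a * b + b\<^sup>2) / 2
      + a * (r1 + a / 6 + b / 2) + - (a + b) * (r2 + a / 2 + b)"
    using V_KKT(4,5)[OF assms] by (metis L_affine a_def b_def)
  also have "\<dots> = q_cand r1 r2 c i"
    by (cases i) (simp_all add: a_def b_def field_simps power2_eq_square)
  finally show ?thesis .
qed

section \<open>The regions partition the half space; the equivalences\<close>

lemma V_cover:
  assumes "c > 0"
  shows "\<exists>i. (r1, r2, c) \<in> V i"
proof (rule ccontr)
  assume "\<nexists>i. (r1, r2, c) \<in> V i"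
  then have "(r1, r2, c) \<notin> V I1" "(r1, r2, c) \<notin> V I2" "(r1, r2, c) \<notin> V I3"
    "(r1, r2, c) \<notin> V I4" "(r1, r2, c) \<notin> V I5" "(r1, r2, c) \<notin> V I6"
    "(r1, r2, c) \<notin> V I7" "(r1, r2, c) \<notin> V I8" "(r1, r2, c) \<notin> V I9"
    by blast+
  then show False
    using assms unfolding V_iff[OF assms] abs_le_iff by argo
qed

lemma inj_sgn_pair: "sgn_pair i = sgn_pair j \<longleftrightarrow> i = j"
  by (cases i; cases j) auto

text \<open>If \<open>j\<close> is the case whose region contains the parameters, then A, C, and B
  together with membership in \<open>V i\<close> all reduce to \<open>i = j\<close>.\<close>

theorem theorem3p1:
  fixes s0 sf v0 vf r1 r2 c :: real and u_c :: "real \<Rightarrow> real"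
  assumes "r1 = v0 + s0 - sf" and "r2 = v0 - vf"
    and "c > 0"
    and "is_arg_min (\<lambda>u. L r1 r2 u c) (\<lambda>u. u \<in> L2_unit) u_c"
  shows "(\<exists>!i. (sgn (h1 r1 u_c), sgn (h2 r2 u_c)) = sgn_pair i) \<and>
    (\<forall>i. let A = ((sgn (h1 r1 u_c), sgn (h2 r2 u_c)) = sgn_pair i);
             B = (AE t\<in>{0..1} in lebesgue. u_c t = u_cand r1 r2 c i t);
             C = (L r1 r2 u_c c = q_cand r1 r2 c i \<and> (r1, r2, c) \<in> V i)
         in (A \<longleftrightarrow> C) \<and>
            (A \<longleftrightarrow> B \<and> (r1, r2, c) \<in> V i) \<and>
            (\<not> ambiguous r1 r2 c i \<longrightarrow> (A \<longleftrightarrow> B)))"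
proof -
  have cand: "u_cand r1 r2 c i = (\<lambda>t. cand_slope r1 r2 c i * t + u_cand r1 r2 c i 0)" for i
    using u_cand_affine by blast
  have uc: "u_c \<in> L2_unit" using assms(4) by (simp add: is_arg_min_def)
  have V: "(AE t\<in>{0..1} in lebesgue. u_c t = u_cand r1 r2 c i t) \<and>
      (sgn (h1 r1 u_c), sgn (h2 r2 u_c)) = sgn_pair i \<and> L r1 r2 u_c c = q_cand r1 r2 c i"
    if i: "(r1, r2, c) \<in> V i" for i
  proof -
    have ae: "AE t\<in>{0..1} in lebesgue. u_c t = cand_slope r1 r2 c i * t + u_cand r1 r2 c i 0"
      using V_KKT[OF i] by (intro arg_min_L_affine[OF assms(4)])
    note eq = AE_unit_interval_cong[OF uc affine_L2_unit ae]
    show ?thesis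
      using ae V_KKT(3)[OF i] L_cand_eq_q_cand[OF i]
      unfolding eq h1_affine h2_affine
      by (simp flip: cand u_cand_affine)
  qed
  obtain j where j: "(r1, r2, c) \<in> V j" using V_cover[OF assms(3)] by blast
  have A_iff: "(sgn (h1 r1 u_c), sgn (h2 r2 u_c)) = sgn_pair i \<longleftrightarrow> i = j" for i
    using V[OF j] by (metis inj_sgn_pair)
  \<comment> \<open>Disjointness: a triple in two regions would give the one function
    \<open>u_c\<close> two different sign pairs.\<close>
  have V_eq: "(r1, r2, c) \<in> V i \<longleftrightarrow> i = j" for i
    using V A_iff j by blast
  \<comment> \<open>The formula for \<open>u_c\<close> shows only that candidates \<open>i\<close>
    and \<open>j\<close> coincide; if \<open>i\<close> and \<open>j\<close> differ, \<open>j\<close>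
    witnesses the ambiguity.\<close>
  have B: "i = j \<or> ambiguous r1 r2 c i"
    if B: "AE t\<in>{0..1} in lebesgue. u_c t = u_cand r1 r2 c i t" for i
  proof -
    have "AE t\<in>{0..1} in lebesgue. u_cand r1 r2 c i t = u_cand r1 r2 c j t"
      using B V[OF j, THEN conjunct1] by eventually_elim auto
    then have "AE t\<in>{0..1} in lebesgue. cand_slope r1 r2 c i * t + u_cand r1 r2 c i 0
        = cand_slope r1 r2 c j * t + u_cand r1 r2 c j 0"
      by (simp flip: u_cand_affine)
    \<comment> \<open>Agreement almost everywhere becomes agreement at every point, as
      \<open>ambiguous\<close> demands.\<close>
    from AE_affine_eq[OF this] have "u_cand r1 r2 c i = u_cand r1 r2 c j"
      using cand[of i] cand[of j] by metis
    then show ?thesis using j by (auto simp: ambiguous_def)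
  qed
  show ?thesis
    unfolding Let_def A_iff V_eq using V[OF j] B by auto
qed

end
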